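(* For every $n\ge1$, the second-order Eulerian polynomial $C_n(x)$ satisfies $$C_n(x)=\sum_{T\in\mathrm{SYT}(n)}G_T\;\lambda(T)!\;x^{\,n+1-\ell(\lambda(T))}.$$
   Context: **Second-order Eulerian polynomials.** A Stirling permutation of order $n$ is a permutation $\sigma=\sigma_1\cdots\sigma_{2n}$ of the multiset $\{1,1,2,2,\ldots,n,n\}$ such that for each $i$ all entries between the two occurrences of $i$ are at least $i$. A descent is an index $i\in\{1,\ldots,2n\}$ with $\sigma_i>\sigma_{i+1}$ or $i=2n$; $\mathrm{des}(\sigma)$ is the number of descents. $C_n(x)=\sum_\sigma x^{\mathrm{des}(\sigma)}$, summed over all Stirling permutations of order $n$. **Standard Young tableaux.** $\mathrm{SYT}(n)$ is the set of standard Young tableaux of size $n$, drawn with rows numbered from bottom to top: for a partition $\lambda=(\lambda_1\ge\lambda_2\ge\cdots)$ of $n$, row $r$ has $\lambda_r$ left-justified boxes, the boxes are filled with $1,\ldots,n$ each used once, rows increase from left to right and columns increase from bottom to top. $\lambda(T)=(\lambda_1,\ldots,\lambda_\ell)$ (positive parts) is the shape of $T$, $\ell(\lambda(T))=\ell$ is its number of nonzero parts, and $\lambda(T)!=\lambda_1!\lambda_2!\cdots\lambda_\ell!$. **$g$-index.** To the left of $T\in\mathrm{SYT}(n)$ one adds a special column (column 0) of $n$ boxes in rows $1,\ldots,n$, the box in row $r$ containing the label $r$. If $v\in\{1,\ldots,n\}$ is in column $i\ge1$ and row $j\ge 1$ of $T$, $g_T(v)$ is the number of boxes in column $i-1$ and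 in rows $j'\ge j$ whose entry is less than or equal to $v$ (for $i=1$ the boxes counted are those of column 0). The $g$-index of $T$ is $G_T=g_T(1)g_T(2)\cdots g_T(n)$. *)

theory Defs
  imports
    "HOL-Combinatorics.Multiset_Permutations"
    "HOL-Computational_Algebra.Polynomial"
begin

text \<open>Words are lists, so the entry \<open>\<sigma>\<^sub>i\<close> of a word is \<open>\<sigma> ! (i - 1)\<close>.\<close>

definition stirling_perms :: "nat \<Rightarrow> nat list set" where
  "stirling_perms n =
     {\<sigma> \<in> permutations_of_multiset (mset_set {1..n} + mset_set {1..n}).
        \<forall>a b c. a < b \<and> b < c \<and> c < length \<sigma> \<and> \<sigma> ! a = \<sigma> ! c \<longrightarrow> \<sigma> ! a \<le> \<sigma> ! b}"

definition des :: "nat list \<Rightarrow> nat" where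
  "des \<sigma> = card {i \<in> {1..length \<sigma>}. i = length \<sigma> \<or> \<sigma> ! (i - 1) > \<sigma> ! i}"

definition second_order_eulerian :: "nat \<Rightarrow> int poly" where
  "second_order_eulerian n = (\<Sum>\<sigma>\<in>stirling_perms n. monom 1 (des \<sigma>))"

text \<open>A tableau is the list of its rows, from bottom to top, each row being read from left to
  right. The entry in row \<open>r\<close> and column \<open>c\<close> (both counted from 1) is \<open>T ! (r - 1) ! (c - 1)\<close>.\<close>

definition shape :: "nat list list \<Rightarrow> nat list" where
  "shape T = map length T"

definition SYT :: "nat \<Rightarrow> nat list list set" where
  "SYT n =
     {T. sorted_wrt (\<ge>) (shape T) \<and> 0 \<notin> set (shape T) \<and>
         concat T \<in> permutations_of_set {1..n} \<and>
         (\<forall>row\<in>set T. sorted_wrt (<) row) \<and>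
         (\<forall>r r' c. r < r' \<and> r' < length T \<and> c < length (T ! r') \<longrightarrow> T ! r ! c < T ! r' ! c)}"

definition part_factorial :: "nat list \<Rightarrow> nat" where
  "part_factorial ps = (\<Prod>p\<leftarrow>ps. fact p)"

definition tableau_size :: "nat list list \<Rightarrow> nat" where
  "tableau_size T = length (concat T)"

text \<open>The tableau with the special column 0 added on the left. The index of an entry in its row
  is now its column number, while row numbers are still shifted by one. Rows above the top
  row of \<open>T\<close> contain only their box in column 0.\<close>

definition add_column0 :: "nat list list \<Rightarrow> nat list list" where
  "add_column0 T =
     map (\<lambda>r. Suc r # (if r < length T then T ! r else [])) [0..<tableau_size T]"

definition box_of :: "nat list list \<Rightarrow> nat \<Rightarrow> nat \<times> nat" where
  "box_of T v = (THE (r, c). r < length T \<and> c < length (T ! r) \<and> T ! r ! c = v)"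

text \<open>If \<open>box_of T v = (r, c)\<close>, then \<open>v\<close> lies in column \<open>c + 1\<close> of \<open>T\<close>; hence the column
  immediately to its left has index \<open>c\<close> in \<open>add_column0 T\<close>.\<close>

definition g_val :: "nat list list \<Rightarrow> nat \<Rightarrow> nat" where
  "g_val T v =
     (let (r, c) = box_of T v; E = add_column0 T
      in card {r'. r \<le> r' \<and> r' < length E \<and> c < length (E ! r') \<and> E ! r' ! c \<le> v})"

definition g_index :: "nat list list \<Rightarrow> nat" where
  "g_index T = (\<Prod>v=1..tableau_size T. g_val T v)"

end

theory Submission
  imports Defs
begin

text \<open>Both sides satisfy the recurrence
  \<open>P\<^sub>n\<^sub>+\<^sub>1 = (2n + 1) x P\<^sub>n + x (1 - x) P\<^sub>n'\<close>, which sends \<open>x\<^sup>k\<close> to \<open>k x\<^sup>k + (2n + 1 - k) x\<^sup>k\<^sup>+\<^sup>1\<close>.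
  For Stirling permutations it comes from inserting the pair \<open>n + 1, n + 1\<close> into one of the \<open>2n + 1\<close>
  gaps: the number of descents is unchanged if the gap is a descent and grows by one otherwise.
  For tableaux it comes from adding the box with entry \<open>n + 1\<close> to a tableau with \<open>l\<close> rows, which
  multiplies the weight by the \<open>g\<close>-value of the new box and by the new length of its row. A new row
  has \<open>g\<close>-value \<open>n + 1 - l\<close>. Extending a row of length \<open>p\<close> has \<open>g\<close>-value the number of rows of
  length \<open>p\<close>, so the extensions contribute the sum of \<open>p + 1\<close> over all rows, which is \<open>n + l\<close>.
  Hence the recurrence depends on the tableau only through \<open>l\<close>. The right-hand side is \<open>x\<close>
  instead of \<open>1\<close> for \<open>n = 0\<close>, but the recurrence sends both to \<open>x\<close>.\<close>

section \<open>The recurrence operator\<close>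

definition eulerian_step :: "nat \<Rightarrow> int poly \<Rightarrow> int poly" where
  "eulerian_step n p = monom (2 * int n + 1) 1 * p + (monom 1 1 - monom 1 2) * pderiv p"

lemma eulerian_step_monom:
  "eulerian_step n (monom a k) = monom (int k * a) k + monom ((2 * int n + 1 - int k) * a) (Suc k)"
\<comment> \<open>At \<open>k = 0\<close> the exponent \<open>k - 1\<close> of the derivative
  truncates to \<open>0\<close>, so the generic computation is confined to
  \<open>Suc m\<close>.\<close>
proof (cases k)
  case 0
  then show ?thesis by (simp add: eulerian_step_def mult_monom pderiv_monom)
next
  case (Suc m)
  then show ?thesis
    by (simp add: eulerian_step_def mult_monom pderiv_monom left_diff_distrib add_monom diff_monom
        flip: add_diff_eq) (simp add: algebra_simps add_monom diff_monom)
qed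

lemma eulerian_step_sum: "eulerian_step n (\<Sum>x\<in>A. f x) = (\<Sum>x\<in>A. eulerian_step n (f x))"
  \<comment> \<open>The first iterated derivative is \<open>pderiv\<close> itself.\<close>
  using higher_pderiv_sum[of 1 f A]
  by (simp add: eulerian_step_def sum.distrib sum_distrib_left)

subsection \<open>Inserting a pair into a Stirling permutation\<close>

definition insert_pair :: "nat \<Rightarrow> 'a \<Rightarrow> 'a list \<Rightarrow> 'a list" where
  "insert_pair p v xs = take p xs @ v # v # drop p xs"

definition stirling_word :: "nat list \<Rightarrow> bool" where
  "stirling_word \<sigma> \<longleftrightarrow>
     (\<forall>a b c. a < b \<and> b < c \<and> c < length \<sigma> \<and> \<sigma> ! a = \<sigma> ! c \<longrightarrow> \<sigma> ! a \<le> \<sigma> ! b)"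

lemma stirling_perms_iff:
  "\<sigma> \<in> stirling_perms n \<longleftrightarrow> mset \<sigma> = mset_set {1..n} + mset_set {1..n} \<and> stirling_word \<sigma>"
  by (simp add: stirling_perms_def stirling_word_def permutations_of_multiset_def)

lemma length_insert_pair [simp]: "length (insert_pair p v xs) = length xs + 2"
  by (simp add: insert_pair_def)

lemma mset_insert_pair [simp]: "mset (insert_pair p v xs) = mset xs + {#v, v#}"
proof -
  have "mset xs = mset (take p xs) + mset (drop p xs)"
    by (metis append_take_drop_id mset_append)
  then show ?thesis by (simp add: insert_pair_def)
qed

lemma nth_insert_pair:
  assumes "p \<le> length xs"
  shows "insert_pair p v xs ! i =
    (if i < p then xs ! i else if i < p + 2 then v else xs ! (i - 2))"
proof -
  consider "i < p" | "i = p" | "i = Suc p" | "i \<ge> p + 2" by linarith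
  then show ?thesis
  proof cases
    case 4
    then have "p + (i - p - 2) = i - 2" "i - p = Suc (Suc (i - p - 2))" by simp_all
    with assms 4 show ?thesis by (simp add: insert_pair_def nth_append)
  qed (use assms in \<open>simp_all add: insert_pair_def nth_append\<close>)
qed

text \<open>The two new letters are adjacent, so they enclose nothing, and they are larger than
  every letter, so they are harmless between two equal ones. All other triples of positions merely
  shift.\<close>

lemma stirling_word_insert_pair:
  assumes p: "p \<le> length \<sigma>" and less: "\<And>x. x \<in> set \<sigma> \<Longrightarrow> x < v"
  shows "stirling_word (insert_pair p v \<sigma>) \<longleftrightarrow> stirling_word \<sigma>"
proof
  assume st: "stirling_word (insert_pair p v \<sigma>)"
  \<comment> \<open>\<open>h\<close> sends a position of the old word to the position of the same
    letter in the new one; it is strictly increasing.\<close>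
  define h where "h i = (if i < p then i else i + 2)" for i
  have h: "insert_pair p v \<sigma> ! h i = \<sigma> ! i" for i
    using p by (auto simp: h_def nth_insert_pair)
  show "stirling_word \<sigma>"
    unfolding stirling_word_def
  proof (intro allI impI)
    fix a b c assume A: "a < b \<and> b < c \<and> c < length \<sigma> \<and> \<sigma> ! a = \<sigma> ! c"
    then have "h a < h b" "h b < h c" "h c < length (insert_pair p v \<sigma>)"
      by (auto simp: h_def)
    then have "insert_pair p v \<sigma> ! h a \<le> insert_pair p v \<sigma> ! h b"
      using st A h[of a] h[of c] unfolding stirling_word_def by metis
    then show "\<sigma> ! a \<le> \<sigma> ! b" by (simp add: h)
  qed
next
  assume st: "stirling_word \<sigma>"
  let ?\<tau> = "insert_pair p v \<sigma>"
  \<comment> \<open>\<open>g\<close> undoes this shift; it is meaningful only away from the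
    positions \<open>p\<close> and \<open>Suc p\<close> of the pair.\<close>
  define g where "g i = (if i < p then i else i - 2)" for i
  show "stirling_word ?\<tau>"
    unfolding stirling_word_def
  proof (intro allI impI)
    fix a b c assume A: "a < b \<and> b < c \<and> c < length ?\<tau> \<and> ?\<tau> ! a = ?\<tau> ! c"
    have idx: "?\<tau> ! i = v \<and> (i = p \<or> i = Suc p) \<or>
      ?\<tau> ! i = \<sigma> ! g i \<and> g i < length \<sigma> \<and> \<sigma> ! g i < v \<and> i \<noteq> p \<and> i \<noteq> Suc p"
      if "i < length ?\<tau>" for i
    proof -
      consider "i < p" | "i = p \<or> i = Suc p" | "p + 2 \<le> i" by linarith
      then show ?thesis
      proof cases
        case 1
        with p show ?thesis by (simp add: nth_insert_pair g_def less)
      next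
        case 2
        with p show ?thesis by (auto simp: nth_insert_pair)
      next
        case 3
        with that have "i - 2 < length \<sigma>" by simp
        with p 3 show ?thesis by (simp add: nth_insert_pair g_def less)
      qed
    qed
    have mono: "g i < g j" if "i < j" "i \<noteq> p" "i \<noteq> Suc p" "j \<noteq> p" "j \<noteq> Suc p" for i j
    proof (cases "j < p")
      case False
      then have "p + 2 \<le> j" using that by linarith
      with that show ?thesis by (cases "i < p") (auto simp: g_def)
    qed (use that in \<open>simp add: g_def\<close>)
    have len: "a < length ?\<tau>" "b < length ?\<tau>" "c < length ?\<tau>" using A by linarith+
    show "?\<tau> ! a \<le> ?\<tau> ! b"
    proof (cases "?\<tau> ! b = v")
      case True
      from idx[OF len(1)] have "?\<tau> ! a \<le> v" by linarith
      with True show ?thesis by simp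
    next
      case False
      with A have not_ac: "\<not> ((a = p \<or> a = Suc p) \<and> (c = p \<or> c = Suc p))"
        using idx[OF len(2)] by linarith
      have b: "?\<tau> ! b = \<sigma> ! g b" "b \<noteq> p" "b \<noteq> Suc p"
        using idx[OF len(2)] False by simp_all
      \<comment> \<open>If just one of the outer positions carried \<open>v\<close>, the equality of
        their letters would contradict that old letters are smaller than \<open>v\<close>.\<close>
      have ac: "?\<tau> ! a = \<sigma> ! g a \<and> ?\<tau> ! c = \<sigma> ! g c \<and> g c < length \<sigma> \<and>
          a \<noteq> p \<and> a \<noteq> Suc p \<and> c \<noteq> p \<and> c \<noteq> Suc p"
        using idx[OF len(1)] idx[OF len(3)] not_ac A by force
      have "g a < g b" "g b < g c" using A b ac by (auto intro: mono)
      moreover have "g c < length \<sigma>" "\<sigma> ! g a = \<sigma> ! g c" using A ac by simp_all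
      ultimately have "\<sigma> ! g a \<le> \<sigma> ! g b"
        using st unfolding stirling_word_def by blast
      then show ?thesis using ac b(1) by simp
    qed
  qed
qed

lemma stirling_perms_set: "\<sigma> \<in> stirling_perms n \<Longrightarrow> set \<sigma> = {1..n}"
  by (drule stirling_perms_iff[THEN iffD1]) (metis Un_absorb finite_atLeastAtMost finite_set_mset_mset_set
      set_mset_mset set_mset_union)

lemma stirling_perms_length: "\<sigma> \<in> stirling_perms n \<Longrightarrow> length \<sigma> = 2 * n"
proof (drule stirling_perms_iff[THEN iffD1], elim conjE)
  assume "mset \<sigma> = mset_set {1..n} + mset_set {1..n}"
  then have "size (mset \<sigma>) = size (mset_set {1..n} + mset_set {1..n})" by simp
  then show ?thesis by simp
qed

lemma mset_set_Suc: "mset_set {Suc 0..Suc n} = add_mset (Suc n) (mset_set {Suc 0..n})"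
  by (simp add: atLeastAtMostSuc_conv)

lemma insert_pair_stirling_perms:
  assumes "\<sigma> \<in> stirling_perms n" "p \<le> length \<sigma>"
  shows "insert_pair p (Suc n) \<sigma> \<in> stirling_perms (Suc n)"
  using assms stirling_perms_set[OF assms(1)] stirling_word_insert_pair[of p \<sigma> "Suc n"]
  by (auto simp: stirling_perms_iff mset_set_Suc)

text \<open>A letter between the two copies of the maximum \<open>Suc n\<close> would have to be at
  least \<open>Suc n\<close>. So the copies are adjacent, and deleting them inverts
  \<open>insert_pair\<close>.\<close>

lemma stirling_perms_Suc_cases:
  assumes "\<tau> \<in> stirling_perms (Suc n)"
  obtains \<sigma> p where "\<sigma> \<in> stirling_perms n" "p \<le> length \<sigma>" "\<tau> = insert_pair p (Suc n) \<sigma>"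
proof -
  let ?v = "Suc n"
  have st: "stirling_word \<tau>" and ms: "mset \<tau> = mset_set {1..n} + mset_set {1..n} + {#?v, ?v#}"
    using assms by (auto simp: stirling_perms_iff mset_set_Suc)
  have le: "x \<le> ?v" if "x \<in> set \<tau>" for x
    using that stirling_perms_set[OF assms] by auto
  have "?v \<in> set \<tau>" using stirling_perms_set[OF assms] by auto
  then obtain xs ys where \<tau>: "\<tau> = xs @ ?v # ys" and xs: "?v \<notin> set xs"
    by (meson split_list_first)
  have "count (mset \<tau>) ?v = 2" using ms by simp
  moreover have "count (mset xs) ?v = 0" using xs by (simp add: not_in_iff[symmetric])
  ultimately have "count (mset ys) ?v = 1" by (simp add: \<tau>)
  then have "?v \<in># mset ys" by (metis count_eq_zero_iff zero_neq_one)
  then have inys: "?v \<in> set ys" by simp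
  then obtain y zs where ys: "ys = y # zs" by (cases ys) auto
  have "y = ?v"
  proof (rule ccontr)
    assume "y \<noteq> ?v"
    with inys ys obtain k where k: "k < length zs" "zs ! k = ?v" by (auto simp: in_set_conv_nth)
    have "\<tau> ! length xs \<le> \<tau> ! Suc (length xs)"
      using st[unfolded stirling_word_def, rule_format, of "length xs" "Suc (length xs)"
          "length xs + 2 + k"] k by (simp add: \<tau> ys nth_append)
    with le[of y] \<open>y \<noteq> ?v\<close> show False by (simp add: \<tau> ys nth_append)
  qed
  define \<sigma> where "\<sigma> = xs @ zs"
  have \<tau>': "\<tau> = insert_pair (length xs) ?v \<sigma>"
    by (simp add: \<tau> ys \<open>y = ?v\<close> \<sigma>_def insert_pair_def)
  have ms': "mset \<sigma> = mset_set {1..n} + mset_set {1..n}" using ms unfolding \<tau>' by simp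
  then have "set_mset (mset \<sigma>) = {1..n}" by simp
  then have "x < ?v" if "x \<in> set \<sigma>" for x using that by auto
  then have "stirling_word \<sigma>"
    using st stirling_word_insert_pair[of "length xs" \<sigma> ?v] unfolding \<tau>' by (simp add: \<sigma>_def)
  with ms' have "\<sigma> \<in> stirling_perms n" by (simp add: stirling_perms_iff)
  then show thesis using \<tau>' that[of \<sigma> "length xs"] by (simp add: \<sigma>_def)
qed

text \<open>Filtering out \<open>v\<close> recovers the word, and the length of the prefix before
  the first \<open>v\<close> recovers the gap.\<close>

lemma insert_pair_inject:
  assumes eq: "insert_pair p v xs = insert_pair q v ys"
    and "p \<le> length xs" "q \<le> length ys" "v \<notin> set xs" "v \<notin> set ys"
  shows "xs = ys" "p = q"
proof -
  have filt: "filter (\<lambda>x. x \<noteq> v) (insert_pair p v xs) = xs" if "v \<notin> set xs" for p xs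
  proof -
    have "filter (\<lambda>x. x \<noteq> v) (insert_pair p v xs) = filter (\<lambda>x. x \<noteq> v) (take p xs @ drop p xs)"
      unfolding insert_pair_def filter_append by simp
    also have "\<dots> = xs" using that by (auto simp: filter_id_conv)
    finally show ?thesis .
  qed
  have tw: "length (takeWhile (\<lambda>x. x \<noteq> v) (insert_pair p v xs)) = p"
    if "v \<notin> set xs" "p \<le> length xs" for p xs
  proof -
    have "\<forall>x\<in>set (take p xs). x \<noteq> v" using that by (auto dest: in_set_takeD)
    then show ?thesis using that by (simp add: insert_pair_def takeWhile_append2)
  qed
  show "xs = ys" using filt[of xs p] filt[of ys q] assms by simp
  show "p = q" using tw[of xs p] tw[of ys q] assms by simp
qed

lemma bij_betw_insert_pair:
  "bij_betw (\<lambda>(\<sigma>, p). insert_pair p (Suc n) \<sigma>) (stirling_perms n \<times> {..2 * n})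
     (stirling_perms (Suc n))"
proof (rule bij_betwI')
  fix x y assume "x \<in> stirling_perms n \<times> {..2 * n}" "y \<in> stirling_perms n \<times> {..2 * n}"
  then show "(case x of (\<sigma>, p) \<Rightarrow> insert_pair p (Suc n) \<sigma>) =
      (case y of (\<sigma>, p) \<Rightarrow> insert_pair p (Suc n) \<sigma>) \<longleftrightarrow> x = y"
    using insert_pair_inject[of "snd x" "Suc n" "fst x" "snd y" "fst y"]
      stirling_perms_set[of "fst x" n] stirling_perms_set[of "fst y" n]
    by (cases x; cases y) (auto simp: stirling_perms_length)
next
  fix x assume "x \<in> stirling_perms n \<times> {..2 * n}"
  then show "(case x of (\<sigma>, p) \<Rightarrow> insert_pair p (Suc n) \<sigma>) \<in> stirling_perms (Suc n)"
    by (auto intro!: insert_pair_stirling_perms simp: stirling_perms_length)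
next
  fix \<tau> assume "\<tau> \<in> stirling_perms (Suc n)"
  then obtain \<sigma> p where "\<sigma> \<in> stirling_perms n" "p \<le> length \<sigma>" "\<tau> = insert_pair p (Suc n) \<sigma>"
    by (rule stirling_perms_Suc_cases)
  then show "\<exists>x\<in>stirling_perms n \<times> {..2 * n}. \<tau> = (case x of (\<sigma>, p) \<Rightarrow> insert_pair p (Suc n) \<sigma>)"
    by (intro bexI[of _ "(\<sigma>, p)"]) (auto simp: stirling_perms_length)
qed

section \<open>Descents after inserting a pair\<close>

text \<open>A descent \<open>i\<close> has the same number as the gap with \<open>i\<close> letters
  on its left. Thus gap \<open>0\<close> is never a descent, and the gap at the end of a nonempty
  word always is.\<close>

definition descents :: "nat list \<Rightarrow> nat set" where
  "descents \<sigma> = {i \<in> {1..length \<sigma>}. i = length \<sigma> \<or> \<sigma> ! (i - 1) > \<sigma> ! i}"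

lemma finite_descents [simp]: "finite (descents \<sigma>)"
  by (simp add: descents_def)

text \<open>Gap \<open>p\<close> becomes three gaps: \<open>p\<close> is followed by the larger
  letter \<open>v\<close>, \<open>p + 1\<close> separates equal letters, and \<open>p + 2\<close> is
  a descent because it follows \<open>v\<close>. Later gaps move by two.\<close>

lemma descents_insert_pair:
  assumes p: "p \<le> length \<sigma>" and less: "\<And>x. x \<in> set \<sigma> \<Longrightarrow> x < v"
  shows "descents (insert_pair p v \<sigma>) =
    {i \<in> descents \<sigma>. i < p} \<union> {p + 2} \<union> (\<lambda>i. i + 2) ` {i \<in> descents \<sigma>. p < i}"
proof (rule set_eqI)
  fix i
  have nth: "\<sigma> ! j < v" if "j < length \<sigma>" for j using that less by simp
  consider "i < p" | "i = p" | "i = p + 1" | "i = p + 2" | "p + 2 < i" by linarith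
  then show "i \<in> descents (insert_pair p v \<sigma>) \<longleftrightarrow>
    i \<in> {i \<in> descents \<sigma>. i < p} \<union> {p + 2} \<union> (\<lambda>i. i + 2) ` {i \<in> descents \<sigma>. p < i}"
  proof cases
    case 2
    with p nth[of "p - 1"] show ?thesis
      by (cases p) (auto simp: descents_def nth_insert_pair)
  next
    case 4
    with p nth[of p] show ?thesis
      \<comment> \<open>At the end of the word, \<open>p + 2\<close> is a descent by convention;
        elsewhere it is one because \<open>v\<close> exceeds the next letter.\<close>
      by (cases "p = length \<sigma>") (auto simp: descents_def nth_insert_pair)
  next
    case 5
    define k where "k = i - 2"
    with 5 have "i = k + 2" "p < k" by auto
    then have "\<not> k + 2 - 1 < p" "\<not> k + 2 - 1 < p + 2" "k + 2 - 1 - 2 = k - 1" by auto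
    with \<open>i = k + 2\<close> \<open>p < k\<close> p show ?thesis by (auto simp: descents_def nth_insert_pair)
  qed (use p in \<open>auto simp: descents_def nth_insert_pair\<close>)
qed

lemma des_insert_pair:
  assumes p: "p \<le> length \<sigma>" and less: "\<And>x. x \<in> set \<sigma> \<Longrightarrow> x < v"
  shows "des (insert_pair p v \<sigma>) = (if p \<in> descents \<sigma> then des \<sigma> else Suc (des \<sigma>))"
proof -
  let ?L = "{i \<in> descents \<sigma>. i < p}" and ?R = "{i \<in> descents \<sigma>. p < i}"
  have "des (insert_pair p v \<sigma>) = card (?L \<union> {p + 2} \<union> (\<lambda>i. i + 2) ` ?R)"
    using descents_insert_pair[OF assms] by (simp add: des_def descents_def)
  also have "\<dots> = card (?L \<union> {p + 2}) + card ((\<lambda>i. i + 2) ` ?R)"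
    by (rule card_Un_disjoint) auto
  also have "card (?L \<union> {p + 2}) = Suc (card ?L)" by simp
  also have "card ((\<lambda>i. i + 2) ` ?R) = card ?R" by (rule card_image) (simp add: inj_on_def)
  finally have 1: "des (insert_pair p v \<sigma>) = Suc (card ?L + card ?R)" by simp
  \<comment> \<open>The last set is empty or the singleton of \<open>p\<close>, so its cardinality
    records whether the split gap was a descent.\<close>
  have "descents \<sigma> = (?L \<union> ?R) \<union> {i. i = p \<and> p \<in> descents \<sigma>}"
    by (rule set_eqI) (auto simp: not_less le_less)
  also have "card \<dots> = card (?L \<union> ?R) + card {i. i = p \<and> p \<in> descents \<sigma>}"
    by (rule card_Un_disjoint) auto
  also have "card (?L \<union> ?R) = card ?L + card ?R"
    by (rule card_Un_disjoint) auto
  finally have "des \<sigma> = card ?L + card ?R + card {i. i = p \<and> p \<in> descents \<sigma>}"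
    by (simp add: des_def descents_def)
  with 1 show ?thesis by simp
qed

lemma sum_monom_des_insert_pair:
  assumes "\<sigma> \<in> stirling_perms n"
  shows "(\<Sum>p\<le>2 * n. monom 1 (des (insert_pair p (Suc n) \<sigma>))) =
    eulerian_step n (monom 1 (des \<sigma>))"
proof -
  have len: "length \<sigma> = 2 * n" using assms by (rule stirling_perms_length)
  have sub: "descents \<sigma> \<subseteq> {..2 * n}" by (auto simp: descents_def len)
  have card: "card (descents \<sigma>) = des \<sigma>" by (simp add: des_def descents_def)
  \<comment> \<open>This bound makes the natural-number subtraction
    \<open>2 * n + 1 - des \<sigma>\<close> agree with the integer one in
    \<open>eulerian_step_monom\<close>.\<close>
  then have le: "des \<sigma> \<le> 2 * n + 1" using card_mono[OF _ sub] by simp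
  have "(\<Sum>p\<le>2 * n. monom 1 (des (insert_pair p (Suc n) \<sigma>)) :: int poly) =
    (\<Sum>p\<le>2 * n. if p \<in> descents \<sigma> then monom 1 (des \<sigma>) else monom 1 (Suc (des \<sigma>)))"
    using stirling_perms_set[OF assms]
    by (intro sum.cong refl) (subst des_insert_pair; auto simp: len)
  also have "\<dots> = (\<Sum>p\<in>descents \<sigma>. monom 1 (des \<sigma>)) +
      (\<Sum>p\<in>{..2 * n} - descents \<sigma>. monom 1 (Suc (des \<sigma>)))"
    using sub by (simp add: sum.If_cases Int_absorb1 Diff_eq)
  also have "\<dots> = of_nat (des \<sigma>) * monom 1 (des \<sigma>) +
      of_nat (2 * n + 1 - des \<sigma>) * monom 1 (Suc (des \<sigma>))"
    using sub by (simp add: card card_Diff_subset)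
  also have "\<dots> = eulerian_step n (monom 1 (des \<sigma>))"
    unfolding of_nat_monom[of "des \<sigma>"] of_nat_monom[of "2 * n + 1 - des \<sigma>"]
    using le by (simp add: mult_monom eulerian_step_monom of_nat_diff)
  finally show ?thesis .
qed

lemma second_order_eulerian_Suc:
  "second_order_eulerian (Suc n) = eulerian_step n (second_order_eulerian n)"
proof -
  have "second_order_eulerian (Suc n) =
    (\<Sum>(\<sigma>, p)\<in>stirling_perms n \<times> {..2 * n}. monom 1 (des (insert_pair p (Suc n) \<sigma>)))"
    unfolding second_order_eulerian_def
    by (subst sum.reindex_bij_betw[OF bij_betw_insert_pair, symmetric])
      (simp add: case_prod_unfold)
  also have "\<dots> = (\<Sum>\<sigma>\<in>stirling_perms n. \<Sum>p\<le>2 * n. monom 1 (des (insert_pair p (Suc n) \<sigma>)))"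
    by (rule sum.cartesian_product[symmetric])
  also have "\<dots> = eulerian_step n (second_order_eulerian n)"
    by (simp add: sum_monom_des_insert_pair second_order_eulerian_def eulerian_step_sum)
  finally show ?thesis .
qed

subsection \<open>Adding a box to a standard Young tableau\<close>

text \<open>The default \<open>[]\<close> lets row conditions range over all indices, and fits the
  rows above \<open>T\<close> that hold only a box of column 0.\<close>

definition row :: "'a list list \<Rightarrow> nat \<Rightarrow> 'a list" where
  "row T r = (if r < length T then T ! r else [])"

lemma row_nonempty_iff: "[] \<notin> set T \<Longrightarrow> row T r \<noteq> [] \<longleftrightarrow> r < length T"
  by (auto simp: row_def dest: nth_mem)

lemma row_eqI:
  assumes "[] \<notin> set T" "[] \<notin> set U" "\<And>r. row T r = row U r"
  shows "T = U"
proof -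
  have "r < length T \<longleftrightarrow> r < length U" for r using assms row_nonempty_iff by metis
  then have "length T = length U" by (metis linorder_neqE_nat less_irrefl)
  then show ?thesis using assms(3) by (intro nth_equalityI) (simp_all add: row_def, metis+)
qed

lemma set_concat_row: "set (concat T) = (\<Union>r. set (row T r))"
  by (force simp: row_def in_set_conv_nth)

text \<open>This is the uniqueness behind the definite description in \<open>box_of\<close>.\<close>

lemma row_nth_inject:
  assumes d: "distinct (concat T)"
    and "c < length (row T r)" "c' < length (row T r')" "row T r ! c = row T r' ! c'"
  shows "r = r' \<and> c = c'"
  using assms
proof (induction T arbitrary: r r')
  case Nil
  then show ?case by (simp add: row_def)
next
  case (Cons xs T)
  have row: "row (xs # T) k = (case k of 0 \<Rightarrow> xs | Suc j \<Rightarrow> row T j)" for k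
    by (simp add: row_def split: nat.split)
  have disj: "xs ! c \<noteq> row T j ! c'" if "c < length xs" "c' < length (row T j)" for c c' j
  proof -
    have "row T j ! c' \<in> set (concat T)"
      using nth_mem[OF that(2)] unfolding set_concat_row by blast
    with Cons.prems(1) nth_mem[OF that(1)] show ?thesis by (auto simp del: set_concat)
  qed
  show ?case
  proof (cases r; cases r')
    fix j j' assume "r = Suc j" "r' = Suc j'"
    with Cons.prems Cons.IH[of j j'] show ?thesis by (simp add: row)
  next
    fix j assume "r = 0" "r' = Suc j"
    with Cons.prems disj[of c c' j] show ?thesis by (simp add: row)
  next
    fix j assume "r = Suc j" "r' = 0"
    with Cons.prems disj[of c' c j] show ?thesis by (simp add: row)
  next
    assume "r = 0" "r' = 0"
    with Cons.prems show ?thesis by (simp add: row nth_eq_iff_index_eq)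
  qed
qed

text \<open>In terms of \<open>row\<close> the index bounds disappear: above the top row the length
  condition is trivial and the column condition vacuous.\<close>

lemma SYT_iff:
  "T \<in> SYT n \<longleftrightarrow> [] \<notin> set T \<and> mset (concat T) = mset_set {1..n} \<and>
     (\<forall>r r'. r \<le> r' \<longrightarrow> length (row T r') \<le> length (row T r)) \<and>
     (\<forall>r. sorted_wrt (<) (row T r)) \<and>
     (\<forall>r r' c. r < r' \<and> c < length (row T r') \<longrightarrow> row T r ! c < row T r' ! c)"
proof -
  have "0 \<notin> set (shape T) \<longleftrightarrow> [] \<notin> set T" by (auto simp: shape_def)
  moreover have "concat T \<in> permutations_of_set {1..n} \<longleftrightarrow> mset (concat T) = mset_set {1..n}"
    by (subst permutations_of_set_altdef) (simp_all add: permutations_of_multiset_def)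
  moreover have "sorted_wrt (\<ge>) (shape T) \<longleftrightarrow>
      (\<forall>r r'. r \<le> r' \<longrightarrow> length (row T r') \<le> length (row T r))"
  proof -
    have "(\<forall>r r'. r \<le> r' \<longrightarrow> length (row T r') \<le> length (row T r)) \<longleftrightarrow>
        (\<forall>r r'. r < r' \<and> r' < length T \<longrightarrow> length (row T r') \<le> length (row T r))" (is "?A \<longleftrightarrow> ?B")
    proof
      assume B: ?B
      show ?A
      proof (intro allI impI)
        fix r r' :: nat assume "r \<le> r'"
        then consider "r = r'" | "r < r'" "r' < length T" | "length T \<le> r'" by linarith
        then show "length (row T r') \<le> length (row T r)"
          by cases (use B in \<open>auto simp: row_def\<close>)
      qed
    qed simp
    then show ?thesis by (auto simp: shape_def sorted_wrt_iff_nth_less row_def)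
  qed
  moreover have "(\<forall>xs\<in>set T. sorted_wrt (<) xs) \<longleftrightarrow> (\<forall>r. sorted_wrt (<) (row T r))"
    by (auto simp: row_def) (metis in_set_conv_nth)
  moreover have "(\<forall>r r' c. r < r' \<and> r' < length T \<and> c < length (T ! r') \<longrightarrow> T ! r ! c < T ! r' ! c) \<longleftrightarrow>
     (\<forall>r r' c. r < r' \<and> c < length (row T r') \<longrightarrow> row T r ! c < row T r' ! c)"
    by (auto simp: row_def)
  ultimately show ?thesis unfolding SYT_def by blast
qed

lemma
  assumes "T \<in> SYT n"
  shows SYT_nonempty: "[] \<notin> set T"
    and SYT_mset: "mset (concat T) = mset_set {1..n}"
    and SYT_length_mono: "r \<le> r' \<Longrightarrow> length (row T r') \<le> length (row T r)"
    and SYT_row_sorted: "sorted_wrt (<) (row T r)"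
    and SYT_column: "r < r' \<Longrightarrow> c < length (row T r') \<Longrightarrow> row T r ! c < row T r' ! c"
  using assms unfolding SYT_iff by blast+

lemma SYT_set: "T \<in> SYT n \<Longrightarrow> set (concat T) = {1..n}"
  by (metis SYT_mset finite_atLeastAtMost finite_set_mset_mset_set set_mset_mset)

lemma SYT_distinct: "T \<in> SYT n \<Longrightarrow> distinct (concat T)"
  by (auto simp: SYT_def permutations_of_set_def)

lemma SYT_size: "T \<in> SYT n \<Longrightarrow> tableau_size T = n"
  by (drule SYT_mset) (metis card_atLeastAtMost diff_Suc_1 size_mset size_mset_set tableau_size_def)

lemma sum_length_row: "(\<Sum>r<length T. length (row T r)) = length (concat T)"
  by (simp add: length_concat sum_list_sum_nth row_def atLeast0LessThan)

text \<open>Every row has a box. The bound keeps the exponent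
  \<open>n + 1 - length (shape T)\<close> from truncating.\<close>

lemma SYT_length_le: assumes "T \<in> SYT n" shows "length T \<le> n"
proof -
  have "length T = (\<Sum>r<length T. 1)" by simp
  also have "\<dots> \<le> (\<Sum>r<length T. length (row T r))"
    using row_nonempty_iff[OF SYT_nonempty[OF assms]] by (intro sum_mono) (auto simp: Suc_le_eq)
  also have "\<dots> = n" using SYT_size[OF assms] by (simp add: sum_length_row tableau_size_def)
  finally show ?thesis .
qed

lemma SYT_row_subset: "T \<in> SYT n \<Longrightarrow> set (row T r) \<subseteq> {1..n}"
  using SYT_set[of T n] set_concat_row[of T] by auto

lemma SYT_0: "SYT 0 = {[]}"
proof -
  have "T = []" if "T \<in> SYT 0" for T
    using SYT_size[OF that] SYT_length_le[OF that] by simp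
  moreover have "[] \<in> SYT 0" by (simp add: SYT_iff row_def)
  ultimately show ?thesis by auto
qed

section \<open>Adding and removing the largest entry\<close>

text \<open>The index \<open>r = length T\<close> opens a new top row, in line with
  \<open>row T r\<close> being empty there.\<close>

definition add_box :: "nat \<Rightarrow> 'a \<Rightarrow> 'a list list \<Rightarrow> 'a list list" where
  "add_box r v T = (if r < length T then T[r := T ! r @ [v]] else T @ [[v]])"

lemma row_add_box:
  "r \<le> length T \<Longrightarrow> row (add_box r v T) i = (if i = r then row T r @ [v] else row T i)"
  by (auto simp: add_box_def row_def nth_append)

lemma mset_concat_add_box: "mset (concat (add_box r v T)) = add_mset v (mset (concat T))"
proof (cases "r < length T")
  case True
  then obtain xs ys where "T = xs @ T ! r # ys" "length xs = r"
    by (metis id_take_nth_drop length_take min.absorb4)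
  \<comment> \<open>Naming the row keeps the equation for \<open>T\<close> from rewriting its own
    right-hand side.\<close>
  then obtain R where R: "T = xs @ R # ys" "length xs = r" by blast
  then have "add_box r v T = xs @ (R @ [v]) # ys" by (auto simp: add_box_def)
  with R show ?thesis by simp
qed (simp add: add_box_def)

lemma length_add_box: "r \<le> length T \<Longrightarrow> length (add_box r v T) = max (length T) (Suc r)"
  by (auto simp: add_box_def)

lemma nonempty_add_box: "[] \<notin> set T \<Longrightarrow> [] \<notin> set (add_box r v T)"
  by (auto simp: add_box_def dest!: set_update_subset_insert[THEN subsetD])

text \<open>These are the rows whose extension keeps the shape a partition. Equivalently for a
  tableau, \<open>r\<close> is the lowest row of its length.\<close>

definition addable :: "'a list list \<Rightarrow> nat set" where
  "addable T = {r. r \<le> length T \<and> (\<forall>i<r. length (row T r) < length (row T i))}"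

text \<open>The new entry exceeds all others, so it may end its row; addability supplies the boxes
  below it, and no box lies above it.\<close>

lemma add_box_SYT:
  assumes T: "T \<in> SYT n" and r: "r \<in> addable T"
  shows "add_box r (Suc n) T \<in> SYT (Suc n)"
  unfolding SYT_iff
proof (intro conjI allI impI)
  let ?U = "add_box r (Suc n) T"
  from r have rl: "r \<le> length T" and ra: "\<And>i. i < r \<Longrightarrow> length (row T r) < length (row T i)"
    by (auto simp: addable_def)
  have le: "x \<le> n" if "x \<in> set (row T i)" for x i
    using SYT_row_subset[OF T, of i] that by auto
  show "[] \<notin> set ?U" using SYT_nonempty[OF T] by (rule nonempty_add_box)
  show "mset (concat ?U) = mset_set {1..Suc n}"
    using SYT_mset[OF T] by (simp only: mset_concat_add_box mset_set_Suc One_nat_def)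
  show "length (row ?U j) \<le> length (row ?U i)" if "i \<le> j" for i j
    using that SYT_length_mono[OF T that] ra[of i] by (auto simp: row_add_box[OF rl])
  show "sorted_wrt (<) (row ?U i)" for i
    using SYT_row_sorted[OF T] le by (auto simp: row_add_box[OF rl] sorted_wrt_append less_Suc_eq_le)
  show "row ?U i ! c < row ?U j ! c" if "i < j \<and> c < length (row ?U j)" for i j c
  proof -
    have "c < length (row T r) \<or> c = length (row T r)" if "j = r"
      using that \<open>i < j \<and> c < length (row ?U j)\<close> by (auto simp: row_add_box[OF rl])
    then consider "j = r" "c = length (row T r)" | "j = r" "c < length (row T r)" | "j \<noteq> r" "i = r" | "j \<noteq> r" "i \<noteq> r"
      by blast
    then show ?thesis
    proof cases
      case 1
      with that ra[of i] have "c < length (row T i)" by simp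
      then have "row T i ! c \<le> n" using le nth_mem by blast
      with 1 that show ?thesis by (simp add: row_add_box[OF rl])
    next
      case 2
      with that SYT_column[OF T, of i j c] show ?thesis
        by (simp add: row_add_box[OF rl] nth_append)
    next
      case 3
      then have "c < length (row T j)" using that by (auto simp: row_add_box[OF rl])
      moreover have "length (row T j) \<le> length (row T i)" using that SYT_length_mono[OF T] by simp
      ultimately show ?thesis using 3 that SYT_column[OF T, of i j c]
        by (simp add: row_add_box[OF rl] nth_append)
    next
      case 4
      with that SYT_column[OF T, of i j c] show ?thesis by (simp add: row_add_box[OF rl])
    qed
  qed
qed

text \<open>The largest entry ends its row and has no box above it, so removing it leaves a standard
  tableau.\<close>

lemma SYT_Suc_cases:
  assumes U: "U \<in> SYT (Suc n)"
  obtains T r where "T \<in> SYT n" "r \<in> addable T" "U = add_box r (Suc n) T"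
proof -
  have "Suc n \<in> set (concat U)" using SYT_set[OF U] by simp
  then obtain r where r: "Suc n \<in> set (row U r)" unfolding set_concat_row by blast
  then have rl: "r < length U" by (auto simp: row_def split: if_splits)
  have le: "x \<le> Suc n" if "x \<in> set (row U i)" for x i
    using SYT_row_subset[OF U, of i] that by auto
  from r obtain ys zs where split: "row U r = ys @ Suc n # zs" by (meson split_list)
  have "zs = []"
    using SYT_row_sorted[OF U, of r] le[of "hd zs" r] unfolding split
    by (cases zs) (auto simp: sorted_wrt_append)
  with split have ys: "row U r = ys @ [Suc n]" by simp
  have above: "length (row U i) \<le> length ys" if "r < i" for i
  proof (rule ccontr)
    assume "\<not> length (row U i) \<le> length ys"
    then have l: "length ys < length (row U i)" by simp
    from SYT_column[OF U that l] le[OF nth_mem[OF l]] show False by (simp add: ys)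
  qed
  \<comment> \<open>If the largest entry was alone in its row, that row must vanish;
    \<open>last\<close> shows that it is then the top row, so \<open>butlast\<close> removes
    it.\<close>
  define T where "T = (if ys = [] then butlast U else U[r := ys])"
  have last: "length U = Suc r" if "ys = []"
  proof (rule ccontr)
    assume "length U \<noteq> Suc r"
    with rl have "Suc r < length U" by simp
    then show False
      using above[of "Suc r"] that row_nonempty_iff[OF SYT_nonempty[OF U], of "Suc r"] by simp
  qed
  have row_T: "row T i = (if i = r then ys else row U i)" for i
    using rl last by (auto simp: T_def row_def nth_butlast)
  have Tne: "[] \<notin> set T"
    using SYT_nonempty[OF U]
    by (auto simp: T_def dest: in_set_butlastD dest!: set_update_subset_insert[THEN subsetD])
  have rT: "r \<le> length T" using rl last by (auto simp: T_def)
  have eq: "U = add_box r (Suc n) T"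
    using SYT_nonempty[OF U] nonempty_add_box[OF Tne]
    by (rule row_eqI) (simp add: row_add_box[OF rT] row_T ys)
  have "T \<in> SYT n"
    unfolding SYT_iff
  proof (intro conjI allI impI)
    show "[] \<notin> set T" by (rule Tne)
    show "mset (concat T) = mset_set {1..n}"
      using SYT_mset[OF U] unfolding eq mset_concat_add_box by (simp add: mset_set_Suc)
    show "length (row T j) \<le> length (row T i)" if "i \<le> j" for i j
      using that SYT_length_mono[OF U that] above[of j] by (auto simp: row_T ys)
    show "sorted_wrt (<) (row T i)" for i
      using SYT_row_sorted[OF U, of r] SYT_row_sorted[OF U, of i]
      by (auto simp: row_T ys sorted_wrt_append)
    show "row T i ! c < row T j ! c" if "i < j \<and> c < length (row T j)" for i j c
    proof -
      have "row U i ! c < row U j ! c"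
        using that by (intro SYT_column[OF U]) (auto simp: row_T ys split: if_splits)
      moreover have "c < length ys" if "i = r"
        using above[of j] \<open>i < j \<and> c < length (row T j)\<close> that by (auto simp: row_T)
      ultimately show ?thesis
        using that by (auto simp: row_T ys nth_append)
    qed
  qed
  moreover have "r \<in> addable T"
    using rT SYT_length_mono[OF U, of _ r] by (auto simp: addable_def row_T ys less_eq_Suc_le)
  ultimately show thesis using eq that by blast
qed

text \<open>The row containing \<open>v\<close> determines \<open>r\<close>; comparing all rows then
  gives the old tableau.\<close>

lemma add_box_inject:
  assumes eq: "add_box r v T = add_box r' v T'"
    and r: "r \<le> length T" "r' \<le> length T'"
    and v: "v \<notin> set (concat T)" "v \<notin> set (concat T')"
    and ne: "[] \<notin> set T" "[] \<notin> set T'"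
  shows "T = T' \<and> r = r'"
proof -
  have v': "v \<notin> set (row T i)" "v \<notin> set (row T' i)" for i
    using v unfolding set_concat_row by blast+
  have row: "(if i = r then row T r @ [v] else row T i) =
      (if i = r' then row T' r' @ [v] else row T' i)" for i
    using eq row_add_box[OF r(1), of v i] row_add_box[OF r(2), of v i] by simp
  have "v \<in> set (row T' r)" if "r \<noteq> r'"
    using row[of r] that by (metis in_set_conv_decomp)
  with v' have "r = r'" by blast
  moreover have "row T i = row T' i" for i
    using row[of i] \<open>r = r'\<close> by (auto split: if_splits)
  ultimately show ?thesis using row_eqI[OF ne] by blast
qed

lemma bij_betw_add_box:
  "bij_betw (\<lambda>(T, r). add_box r (Suc n) T) (SIGMA T:SYT n. addable T) (SYT (Suc n))"
proof (rule bij_betwI')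
  fix x y assume A: "x \<in> (SIGMA T:SYT n. addable T)" "y \<in> (SIGMA T:SYT n. addable T)"
  then have "fst x \<in> SYT n" "fst y \<in> SYT n" by auto
  then show "(case x of (T, r) \<Rightarrow> add_box r (Suc n) T) =
      (case y of (T, r) \<Rightarrow> add_box r (Suc n) T) \<longleftrightarrow> x = y"
    using A add_box_inject[of "snd x" "Suc n" "fst x" "snd y" "fst y"]
      SYT_set[of "fst x" n] SYT_set[of "fst y" n] SYT_nonempty[of "fst x" n] SYT_nonempty[of "fst y" n]
    by (cases x; cases y) (auto simp: addable_def simp del: set_concat)
next
  fix x assume "x \<in> (SIGMA T:SYT n. addable T)"
  then show "(case x of (T, r) \<Rightarrow> add_box r (Suc n) T) \<in> SYT (Suc n)"
    by (auto intro: add_box_SYT)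
next
  fix U assume "U \<in> SYT (Suc n)"
  then obtain T r where "T \<in> SYT n" "r \<in> addable T" "U = add_box r (Suc n) T"
    by (rule SYT_Suc_cases)
  then show "\<exists>x\<in>(SIGMA T:SYT n. addable T). U = (case x of (T, r) \<Rightarrow> add_box r (Suc n) T)"
    by (intro bexI[of _ "(T, r)"]) auto
qed

lemma finite_addable: "finite (addable T)"
  by (rule finite_subset[of _ "{..length T}"]) (auto simp: addable_def)

lemma finite_SYT: "finite (SYT n)"
proof (induction n)
  case 0
  then show ?case by (simp add: SYT_0)
next
  case (Suc n)
  then have "finite (SIGMA T:SYT n. addable T)" by (simp add: finite_addable)
  then show ?case using bij_betw_finite[OF bij_betw_add_box] by blast
qed

section \<open>How the weight changes\<close>

lemma box_of_row:
  assumes d: "distinct (concat T)" and c: "c < length (row T r)"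
  shows "box_of T (row T r ! c) = (r, c)"
  unfolding box_of_def
proof (rule the_equality)
  show "case (r, c) of (r', c') \<Rightarrow> r' < length T \<and> c' < length (T ! r') \<and> T ! r' ! c' = row T r ! c"
    using c by (auto simp: row_def split: if_splits)
next
  fix x :: "nat \<times> nat"
  assume A: "case x of (r', c') \<Rightarrow> r' < length T \<and> c' < length (T ! r') \<and> T ! r' ! c' = row T r ! c"
  obtain r' c' where x: "x = (r', c')" by (cases x)
  with A have "c' < length (row T r')" "row T r' ! c' = row T r ! c" by (auto simp: row_def)
  then show "x = (r, c)" using row_nth_inject[OF d _ c] x by simp
qed

text \<open>Index \<open>c\<close> in \<open>Suc r' # row T r'\<close> is the column left of the
  entry: the label of column 0 if \<open>c = 0\<close>, a genuine entry otherwise. The prepended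
  label explains the weak bound \<open>c \<le> length (row T r')\<close>.\<close>

lemma g_val_row:
  assumes d: "distinct (concat T)" and c: "c < length (row T r)"
  shows "g_val T (row T r ! c) =
    card {r'. r \<le> r' \<and> r' < tableau_size T \<and> c \<le> length (row T r') \<and>
      (Suc r' # row T r') ! c \<le> row T r ! c}"
proof -
  have nth: "add_column0 T ! r' = Suc r' # row T r'" if "r' < tableau_size T" for r'
    using that by (simp add: add_column0_def row_def)
  have len: "length (add_column0 T) = tableau_size T" by (simp add: add_column0_def)
  show ?thesis
    unfolding g_val_def Let_def box_of_row[OF assms] prod.case len
    by (intro arg_cong[of _ _ card] Collect_cong) (auto simp: nth less_Suc_eq_le)
qed

text \<open>The new box and the additional box of column 0 both carry \<open>n + 1 > v\<close>, so
  neither is counted.\<close>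

lemma g_val_add_box_old:
  assumes T: "T \<in> SYT n" and r: "r \<in> addable T" and v: "v \<in> {1..n}"
  shows "g_val (add_box r (Suc n) T) v = g_val T v"
proof -
  let ?U = "add_box r (Suc n) T"
  have U: "?U \<in> SYT (Suc n)" using T r by (rule add_box_SYT)
  have rl: "r \<le> length T" using r by (simp add: addable_def)
  note row_U = row_add_box[OF rl]
  from v obtain i where "v \<in> set (row T i)"
    using SYT_set[OF T] unfolding set_concat_row by blast
  then obtain c where c: "c < length (row T i)" and vc: "row T i ! c = v"
    by (auto simp: in_set_conv_nth)
  have cU: "c < length (row ?U i)" and vU: "row ?U i ! c = v"
    using c vc by (auto simp: row_U nth_append)
  have same: "c \<le> length (row ?U k) \<and> (Suc k # row ?U k) ! c \<le> v \<longleftrightarrow>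
      c \<le> length (row T k) \<and> (Suc k # row T k) ! c \<le> v" for k
    using v by (cases c) (auto simp: row_U nth_append not_less less_Suc_eq le_Suc_eq Suc_le_eq)
  \<comment> \<open>The additional row index is \<open>n\<close>. That row of \<open>T\<close> is
    empty, so only its label \<open>n + 1\<close> could be counted.\<close>
  have below: "k < n" if "k < Suc n" "c \<le> length (row T k)" "(Suc k # row T k) ! c \<le> v" for k
  proof (rule ccontr)
    assume "\<not> k < n"
    then have "k = n" using that by simp
    then have "row T k = []" using SYT_length_le[OF T] by (simp add: row_def)
    then show False using that v \<open>k = n\<close> by simp
  qed
  have "g_val ?U v = card {k. i \<le> k \<and> k < Suc n \<and> c \<le> length (row ?U k) \<and> (Suc k # row ?U k) ! c \<le> v}"
    using g_val_row[OF SYT_distinct[OF U] cU] by (simp only: vU SYT_size[OF U])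
  also have "{k. i \<le> k \<and> k < Suc n \<and> c \<le> length (row ?U k) \<and> (Suc k # row ?U k) ! c \<le> v} =
      {k. i \<le> k \<and> k < n \<and> c \<le> length (row T k) \<and> (Suc k # row T k) ! c \<le> v}"
    using same below less_SucI[of _ n] by blast
  also have "card \<dots> = g_val T v"
    using g_val_row[OF SYT_distinct[OF T] c] by (simp only: vc SYT_size[OF T])
  finally show ?thesis .
qed

text \<open>No entry exceeds \<open>Suc n\<close>, so only the presence of a box in the left column
  matters. Rows from \<open>r\<close> upward are no longer than row \<open>r\<close>, so presence
  means equal length.\<close>

lemma g_val_add_box_new:
  assumes T: "T \<in> SYT n" and r: "r \<in> addable T"
  shows "g_val (add_box r (Suc n) T) (Suc n) =
    card {k. r \<le> k \<and> k \<le> n \<and> length (row T k) = length (row T r)}"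
proof -
  let ?U = "add_box r (Suc n) T" and ?c = "length (row T r)"
  have U: "?U \<in> SYT (Suc n)" using T r by (rule add_box_SYT)
  have rl: "r \<le> length T" using r by (simp add: addable_def)
  note row_U = row_add_box[OF rl]
  have c: "?c < length (row ?U r)" and v: "row ?U r ! ?c = Suc n" by (simp_all add: row_U)
  have le: "(Suc k # row ?U k) ! ?c \<le> Suc n" if "k \<le> n" "?c \<le> length (row ?U k)" for k
  proof (cases ?c)
    case (Suc m)
    then have "row ?U k ! m \<in> set (row ?U k)" using that(2) by simp
    then show ?thesis using Suc SYT_row_subset[OF U, of k] by auto
  qed (use that in simp)
  have len: "?c \<le> length (row ?U k) \<longleftrightarrow> length (row T k) = ?c" if "r \<le> k" for k
    using SYT_length_mono[OF T that] by (auto simp: row_U)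
  have "g_val ?U (Suc n) =
      card {k. r \<le> k \<and> k < Suc n \<and> ?c \<le> length (row ?U k) \<and> (Suc k # row ?U k) ! ?c \<le> Suc n}"
    using g_val_row[OF SYT_distinct[OF U] c] by (simp only: v SYT_size[OF U])
  also have "{k. r \<le> k \<and> k < Suc n \<and> ?c \<le> length (row ?U k) \<and> (Suc k # row ?U k) ! ?c \<le> Suc n} =
      {k. r \<le> k \<and> k \<le> n \<and> length (row T k) = ?c}"
    using le len less_Suc_eq_le by blast
  finally show ?thesis .
qed

lemma g_index_add_box:
  assumes T: "T \<in> SYT n" and r: "r \<in> addable T"
  shows "g_index (add_box r (Suc n) T) =
    g_index T * card {k. r \<le> k \<and> k \<le> n \<and> length (row T k) = length (row T r)}"
proof -
  have "(\<Prod>v=1..n. g_val (add_box r (Suc n) T) v) = (\<Prod>v=1..n. g_val T v)"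
    using g_val_add_box_old[OF assms] by (rule prod.cong[OF refl])
  then show ?thesis
    using g_val_add_box_new[OF assms]
    by (simp add: g_index_def SYT_size[OF T] SYT_size[OF add_box_SYT[OF assms]])
qed

text \<open>The factor is \<open>(p + 1)! / p!\<close>, with \<open>p = 0\<close> for a new
  row.\<close>

lemma part_factorial_add_box:
  assumes "r \<le> length T"
  shows "part_factorial (shape (add_box r v T)) = part_factorial (shape T) * Suc (length (row T r))"
proof (cases "r < length T")
  case True
  define xs R ys where "xs = take r T" and "R = T ! r" and "ys = drop (Suc r) T"
  then have T: "T = xs @ R # ys" and len: "length xs = r"
    using True by (simp_all add: id_take_nth_drop)
  then have "add_box r v T = xs @ (R @ [v]) # ys" "row T r = R"
    by (auto simp: add_box_def row_def)
  then show ?thesis by (simp add: T part_factorial_def shape_def algebra_simps)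
qed (use assms in \<open>simp add: add_box_def row_def part_factorial_def shape_def\<close>)

lemma length_in_addable: "[] \<notin> set T \<Longrightarrow> length T \<in> addable T"
  by (auto simp: addable_def row_def dest: nth_mem)

text \<open>Among the rows of a given length only the lowest one can be extended, and its \<open>g\<close>-value
  counts all of them; so the sum extends over all rows.\<close>

lemma sum_addable_rows:
  assumes T: "T \<in> SYT n"
  shows "(\<Sum>r\<in>addable T - {length T}.
      card {k. r \<le> k \<and> k \<le> n \<and> length (row T k) = length (row T r)} * Suc (length (row T r))) =
    n + length T"
proof -
  let ?L = "\<lambda>r. {k. r \<le> k \<and> k \<le> n \<and> length (row T k) = length (row T r)}"
  let ?A = "addable T - {length T}"
  have fin: "finite ?A" using finite_addable[of T] by simp
  have lt: "r < length T" if "r \<in> ?A" for r using that by (auto simp: addable_def)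
  have ge: "r \<le> k" if "r \<in> addable T" "length (row T k) = length (row T r)" for r k
    using that by (force simp: addable_def not_less[symmetric])
  have disj: "?L r \<inter> ?L s = {}" if "r \<in> ?A" "s \<in> ?A" "r \<noteq> s" for r s
  proof -
    have False if k: "k \<in> ?L r" "k \<in> ?L s" for k
    proof -
      have "length (row T s) = length (row T r)" using k by simp
      then show False using ge[of r s] ge[of s r] \<open>r \<in> ?A\<close> \<open>s \<in> ?A\<close> \<open>r \<noteq> s\<close> by auto
    qed
    then show ?thesis by blast
  qed
  \<comment> \<open>Excluding \<open>length T\<close> discards the class of empty rows; the
    remaining classes of equal length partition the rows of \<open>T\<close>.\<close>
  have cover: "(\<Union>r\<in>?A. ?L r) = {..<length T}"
  proof (rule set_eqI)
    fix k
    have nz: "i < length T \<longleftrightarrow> length (row T i) \<noteq> 0" for i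
      using row_nonempty_iff[OF SYT_nonempty[OF T], of i] by simp
    show "k \<in> (\<Union>r\<in>?A. ?L r) \<longleftrightarrow> k \<in> {..<length T}"
    proof
      assume "k \<in> (\<Union>r\<in>?A. ?L r)"
      then obtain r where "r \<in> ?A" "length (row T k) = length (row T r)" by blast
      then show "k \<in> {..<length T}" using lt nz[of r] nz[of k] by simp
    next
      assume k: "k \<in> {..<length T}"
      \<comment> \<open>The lowest row as long as row \<open>k\<close> is the addable representative
        of its class.\<close>
      define r where "r = (LEAST i. length (row T i) = length (row T k))"
      have r: "length (row T r) = length (row T k)" "r \<le> k"
        unfolding r_def by (rule LeastI[of _ k], simp) (rule Least_le, simp)
      have "length (row T r) < length (row T i)" if "i < r" for i
      proof -
        have "length (row T i) \<noteq> length (row T k)" using that not_less_Least r_def by blast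
        then show ?thesis using r SYT_length_mono[OF T, of i r] that by simp
      qed
      then have "r \<in> ?A" using k r by (auto simp: addable_def)
      then show "k \<in> (\<Union>r\<in>?A. ?L r)" using k r SYT_length_le[OF T] by auto
    qed
  qed
  have "(\<Sum>r\<in>?A. card (?L r) * Suc (length (row T r))) =
      (\<Sum>r\<in>?A. \<Sum>k\<in>?L r. Suc (length (row T k)))"
    by (intro sum.cong refl) simp
  also have "\<dots> = (\<Sum>k\<in>(\<Union>r\<in>?A. ?L r). Suc (length (row T k)))"
    by (rule sum.UNION_disjoint[symmetric]) (use fin disj in auto)
  also have "\<dots> = (\<Sum>k<length T. length (row T k)) + length T"
    unfolding cover by (simp add: sum_Suc)
  also have "\<dots> = n + length T"
    using SYT_size[OF T] by (simp add: sum_length_row tableau_size_def)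
  finally show ?thesis .
qed

section \<open>The recurrence for the tableau sum\<close>

definition tableau_term :: "nat \<Rightarrow> nat list list \<Rightarrow> int poly" where
  "tableau_term n T =
     monom (int (g_index T * part_factorial (shape T))) (n + 1 - length (shape T))"

text \<open>Put \<open>k = n + 1 - l\<close> with \<open>l\<close> rows. A new row keeps the
  exponent \<open>k\<close> and contributes the factor \<open>k\<close>; the extensions raise it by
  one and contribute \<open>n + l = 2n + 1 - k\<close> in total.\<close>

lemma sum_tableau_term_add_box:
  assumes T: "T \<in> SYT n"
  shows "(\<Sum>r\<in>addable T. tableau_term (Suc n) (add_box r (Suc n) T)) =
    eulerian_step n (tableau_term n T)"
proof -
  let ?l = "length T" and ?W = "g_index T * part_factorial (shape T)"
  let ?g = "\<lambda>r. card {k. r \<le> k \<and> k \<le> n \<and> length (row T k) = length (row T r)}"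
  have le: "?l \<le> n" using T by (rule SYT_length_le)
  have trm: "tableau_term (Suc n) (add_box r (Suc n) T) =
      monom (int (?W * (?g r * Suc (length (row T r))))) (Suc n + 1 - max ?l (Suc r))"
    if "r \<in> addable T" for r
  proof -
    have "r \<le> ?l" using that by (simp add: addable_def)
    then have "length (shape (add_box r (Suc n) T)) = max ?l (Suc r)"
      by (simp add: shape_def length_add_box)
    then show ?thesis
      unfolding tableau_term_def g_index_add_box[OF T that] part_factorial_add_box[OF \<open>r \<le> ?l\<close>]
      by (simp only: mult_ac)
  qed
  \<comment> \<open>For a new row the counted boxes are those of column 0 beside empty rows,
    \<open>n + 1 - l\<close> in number.\<close>
  have new: "{k. ?l \<le> k \<and> k \<le> n \<and> length (row T k) = length (row T ?l)} = {?l..n}"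
    by (auto simp: row_def)
  have "(\<Sum>r\<in>addable T. tableau_term (Suc n) (add_box r (Suc n) T)) =
      tableau_term (Suc n) (add_box ?l (Suc n) T) +
      (\<Sum>r\<in>addable T - {?l}. tableau_term (Suc n) (add_box r (Suc n) T))"
    using finite_addable length_in_addable[OF SYT_nonempty[OF T]] by (rule sum.remove)
  also have "tableau_term (Suc n) (add_box ?l (Suc n) T) = monom (int (?W * (n + 1 - ?l))) (n + 1 - ?l)"
    unfolding trm[OF length_in_addable[OF SYT_nonempty[OF T]]] new by (simp add: row_def)
  also have "(\<Sum>r\<in>addable T - {?l}. tableau_term (Suc n) (add_box r (Suc n) T)) =
      (\<Sum>r\<in>addable T - {?l}. monom (int (?W * (?g r * Suc (length (row T r))))) (Suc (n + 1 - ?l)))"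
  proof (rule sum.cong[OF refl])
    fix r assume r: "r \<in> addable T - {?l}"
    then have "max ?l (Suc r) = ?l" by (auto simp: addable_def)
    with r trm[of r] le show "tableau_term (Suc n) (add_box r (Suc n) T) =
        monom (int (?W * (?g r * Suc (length (row T r))))) (Suc (n + 1 - ?l))"
      by (simp only: Diff_iff) (simp add: Suc_diff_le)
  qed
  also have "\<dots> = monom (int (?W * (n + ?l))) (Suc (n + 1 - ?l))"
    by (simp only: sum_addable_rows[OF T, symmetric] sum_distrib_left of_nat_sum monom_sum)
  also have "monom (int (?W * (n + 1 - ?l))) (n + 1 - ?l) + \<dots> = eulerian_step n (tableau_term n T)"
  proof -
    have "int (?W * (n + 1 - ?l)) = int (n + 1 - ?l) * int ?W" by simp
    moreover have "int (?W * (n + ?l)) = (2 * int n + 1 - int (n + 1 - ?l)) * int ?W"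
      using le by (simp add: of_nat_diff)
    ultimately show ?thesis
      by (simp only: tableau_term_def eulerian_step_monom shape_def length_map)
  qed
  finally show ?thesis .
qed

lemma sum_tableau_term_Suc:
  "(\<Sum>U\<in>SYT (Suc n). tableau_term (Suc n) U) = eulerian_step n (\<Sum>T\<in>SYT n. tableau_term n T)"
proof -
  have "(\<Sum>U\<in>SYT (Suc n). tableau_term (Suc n) U) =
      (\<Sum>(T, r)\<in>(SIGMA T:SYT n. addable T). tableau_term (Suc n) (add_box r (Suc n) T))"
    by (subst sum.reindex_bij_betw[OF bij_betw_add_box, symmetric]) (simp add: case_prod_unfold)
  also have "\<dots> = (\<Sum>T\<in>SYT n. \<Sum>r\<in>addable T. tableau_term (Suc n) (add_box r (Suc n) T))"
    by (rule sum.Sigma[symmetric]) (simp_all add: finite_SYT finite_addable)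
  also have "\<dots> = eulerian_step n (\<Sum>T\<in>SYT n. tableau_term n T)"
    by (simp add: sum_tableau_term_add_box eulerian_step_sum)
  finally show ?thesis .
qed

section \<open>Initial values and conclusion\<close>

lemma second_order_eulerian_0: "second_order_eulerian 0 = 1"
proof -
  have "stirling_perms 0 = {[]}" by (auto simp: stirling_perms_iff stirling_word_def)
  then show ?thesis by (simp add: second_order_eulerian_def des_def)
qed

theorem theorem14:
  fixes n :: nat
  assumes "n \<ge> 1"
  shows "second_order_eulerian n =
    (\<Sum>T\<in>SYT n. monom (int (g_index T * part_factorial (shape T)))
                     (n + 1 - length (shape T)))"
proof -
  have "second_order_eulerian n = (\<Sum>T\<in>SYT n. tableau_term n T)"
    using assms
  \<comment> \<open>The induction starts at \<open>1\<close>, because the two sides differ at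
    \<open>0\<close>.\<close>
  proof (induction n rule: dec_induct)
    case base
    have "second_order_eulerian 1 = eulerian_step 0 (monom 1 0)"
      using second_order_eulerian_Suc[of 0] by (simp add: second_order_eulerian_0)
    \<comment> \<open>Both sides are \<open>x\<close>: the coefficient \<open>k\<close> vanishes at
      \<open>k = 0\<close>, and \<open>1 - k\<close> vanishes at \<open>k = 1\<close>.\<close>
    also have "\<dots> = eulerian_step 0 (monom 1 1)"
      unfolding eulerian_step_monom by simp
    also have "\<dots> = eulerian_step 0 (\<Sum>T\<in>SYT 0. tableau_term 0 T)"
      by (simp add: SYT_0 tableau_term_def g_index_def tableau_size_def part_factorial_def shape_def)
    also have "\<dots> = (\<Sum>T\<in>SYT 1. tableau_term 1 T)"
      using sum_tableau_term_Suc[of 0] by simp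
    finally show ?case .
  next
    case (step m)
    then show ?case by (simp add: second_order_eulerian_Suc sum_tableau_term_Suc)
  qed
  then show ?thesis by (simp add: tableau_term_def)
qed

end
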